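(* For every integer $k\ge4$, the class $\mathcal{L}_k$ of permutations that are sums of at most $k$ decreasing permutations is not $2$-composable. In particular, it is not $n$-composable for any even positive integer $n$.
   Context: A permutation of order $n$ is a bijection $\pi:[n]\to[n]$, where $[n]=\{1,\dots,n\}$, also viewed as the sequence $\pi(1),\dots,\pi(n)$; the empty permutation is allowed. A permutation $\pi$ is contained in $\sigma$ if $\sigma$ has a (not necessarily contiguous) subsequence in the same relative order as $\pi$. A permutation class is a set of permutations closed downwards under containment. For permutations of the same order, $(\pi\circ\sigma)(i)=\pi(\sigma(i))$. For permutation classes, $\mathcal{A}\circ\mathcal{B}=\{\pi\circ\varphi : \pi\in\mathcal{A},\varphi\in\mathcal{B},|\pi|=|\varphi|\}$; this is an associative operation on permutation classes. A class $\mathcal{C}$ is $m$-composable if there are permutation classes $\mathcal{C}_1,\dots,\mathcal{C}_m\subsetneq\mathcal{C}$ (repetitions allowed) with $\mathcal{C}\subseteq\mathcal{C}_1\circ\cdots\circ\mathcal{C}_m$. The sum $\pi\oplus\sigma$ of $\pi$ of order $k$ and $\sigma$ of order $l$ is the permutation $\pi(1),\dots,\pi(k),\sigma(1)+k,\dots,\sigma(l)+k$. A permutation is decreasing if it is $n,n-1,\dots,1$ for some $n$. *)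

theory Defs
  imports "HOL-Combinatorics.Permutations"
begin

text \<open>
  A permutation of order \<open>n\<close> is encoded as a pair \<open>(n, f)\<close> with \<open>f\<close> permuting \<open>{1..n}\<close>.
  Since \<open>permutes\<close> forces \<open>f\<close> to be the identity outside \<open>{1..n}\<close>, the encoding is unique;
  the empty permutation is \<open>(0, id)\<close>. The order has to be recorded because \<open>f\<close> alone does not
  determine it.
\<close>

type_synonym fin_perm = "nat \<times> (nat \<Rightarrow> nat)"

abbreviation order :: "fin_perm \<Rightarrow> nat" where
  "order p \<equiv> fst p"

abbreviation app :: "fin_perm \<Rightarrow> nat \<Rightarrow> nat" where
  "app p \<equiv> snd p"

definition is_perm :: "fin_perm \<Rightarrow> bool" where
  "is_perm p \<longleftrightarrow> app p permutes {1..order p}"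

text \<open>The map \<open>h\<close> selects the positions of the subsequence.\<close>

definition contained_in :: "fin_perm \<Rightarrow> fin_perm \<Rightarrow> bool" where
  "contained_in p q \<longleftrightarrow>
     (\<exists>h. strict_mono_on {1..order p} h \<and> h ` {1..order p} \<subseteq> {1..order q} \<and>
          (\<forall>i\<in>{1..order p}. \<forall>j\<in>{1..order p}.
             app p i < app p j \<longleftrightarrow> app q (h i) < app q (h j)))"

definition permutation_class :: "fin_perm set \<Rightarrow> bool" where
  "permutation_class C \<longleftrightarrow>
     (\<forall>q\<in>C. is_perm q) \<and> (\<forall>p q. is_perm p \<longrightarrow> q \<in> C \<longrightarrow> contained_in p q \<longrightarrow> p \<in> C)"

definition class_comp :: "fin_perm set \<Rightarrow> fin_perm set \<Rightarrow> fin_perm set" where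
  "class_comp A B = {(order p, app p \<circ> app q) | p q. p \<in> A \<and> q \<in> B \<and> order p = order q}"

text \<open>Only nonempty lists are of interest; the value at \<open>[]\<close> is the neutral class.\<close>

fun class_comp_list :: "fin_perm set list \<Rightarrow> fin_perm set" where
  "class_comp_list [] = {(n, id) | n. True}"
| "class_comp_list [C] = C"
| "class_comp_list (C # D # Cs) = class_comp C (class_comp_list (D # Cs))"

definition composable :: "nat \<Rightarrow> fin_perm set \<Rightarrow> bool" where
  "composable m C \<longleftrightarrow>
     (\<exists>Cs. length Cs = m \<and> (\<forall>D\<in>set Cs. permutation_class D \<and> D \<subset> C) \<and>
           C \<subseteq> class_comp_list Cs)"

text \<open>
  For positions beyond the total order, \<open>app q\<close> is the identity on the shifted index, so the sum
  of two permutations is again the identity there.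
\<close>

definition perm_sum :: "fin_perm \<Rightarrow> fin_perm \<Rightarrow> fin_perm" where
  "perm_sum p q =
     (order p + order q, \<lambda>i. if i \<le> order p then app p i else app q (i - order p) + order p)"

definition decreasing :: "fin_perm \<Rightarrow> bool" where
  "decreasing p \<longleftrightarrow> is_perm p \<and> (\<forall>i\<in>{1..order p}. app p i = order p + 1 - i)"

definition layered_class :: "nat \<Rightarrow> fin_perm set" where
  "layered_class k =
     {foldr perm_sum ps (0, id) | ps. length ps \<le> k \<and> (\<forall>p\<in>set ps. decreasing p)}"

end

theory Submission
  imports Defs
begin

text \<open>
  A sum of at most \<open>k\<close> decreasing permutations is decreasing on each of at most \<open>k\<close> pieces of its
  domain. Composing an even number \<open>n\<close> of such permutations yields a permutation that is increasing
  on each of at most \<open>k ^ n\<close> pieces. By the pigeonhole principle, a decreasing permutation of order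
  greater than \<open>k ^ n\<close> is not of this form, although it lies in the class.
\<close>

text \<open>The pieces are the colour classes of \<open>c\<close>. They need not be intervals, which
  lets the notion survive composition, where pieces are pulled back along a permutation. Some of the
  \<open>K\<close> colours may be absent.\<close>

definition piecewise_monotone :: "bool \<Rightarrow> nat \<Rightarrow> fin_perm \<Rightarrow> bool" where
  "piecewise_monotone up K p \<longleftrightarrow>
     (\<exists>c. (\<forall>x\<in>{1..order p}. c x < K) \<and>
          (\<forall>x\<in>{1..order p}. \<forall>y\<in>{1..order p}. x < y \<longrightarrow> c x = c y \<longrightarrow>
             (if up then app p x < app p y else app p y < app p x)))"

text \<open>Colour \<open>x\<close> by the pair of \<open>c (app q x)\<close> and
  \<open>d x\<close>. On such a class \<open>q\<close> is monotone, and its image lies in one piece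
  of \<open>p\<close>. Directions multiply like signs, with True as plus, hence
  \<open>s = t\<close>.\<close>

lemma piecewise_monotone_comp:
  assumes p: "piecewise_monotone s K p" and q: "piecewise_monotone t L q"
    and "is_perm q" and order_eq: "order p = order q"
  shows "piecewise_monotone (s = t) (K * L) (order p, app p \<circ> app q)"
proof -
  obtain c where c: "\<And>x. x \<in> {1..order p} \<Longrightarrow> c x < K"
    and mono_p: "\<And>x y. x \<in> {1..order p} \<Longrightarrow> y \<in> {1..order p} \<Longrightarrow> x < y \<Longrightarrow> c x = c y \<Longrightarrow>
            (if s then app p x < app p y else app p y < app p x)"
    using p unfolding piecewise_monotone_def by blast
  obtain d where d: "\<And>x. x \<in> {1..order p} \<Longrightarrow> d x < L"
    and mono_q: "\<And>x y. x \<in> {1..order p} \<Longrightarrow> y \<in> {1..order p} \<Longrightarrow> x < y \<Longrightarrow> d x = d y \<Longrightarrow>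
            (if t then app q x < app q y else app q y < app q x)"
    using q unfolding piecewise_monotone_def order_eq by blast
  have q_in: "app q x \<in> {1..order p}" if "x \<in> {1..order p}" for x
    using \<open>is_perm q\<close> that unfolding is_perm_def order_eq by (simp only: permutes_in_image)
  \<comment> \<open>Encodes the pair of colours as one number below \<open>K * L\<close>; since
    \<open>d x < L\<close>, \<open>div\<close> and \<open>mod\<close> by \<open>L\<close> recover
    both.\<close>
  define e where "e x = c (app q x) * L + d x" for x
  have bound: "e x < K * L" if "x \<in> {1..order p}" for x
  proof -
    have "e x < Suc (c (app q x)) * L"
      using d[OF that] by (simp add: e_def)
    also have "\<dots> \<le> K * L"
      using c[OF q_in[OF that]] by (intro mult_le_mono1) simp
    finally show ?thesis .
  qed
  have mono: "if s = t then app p (app q x) < app p (app q y) else app p (app q y) < app p (app q x)"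
    if x: "x \<in> {1..order p}" and y: "y \<in> {1..order p}" and "x < y" and "e x = e y" for x y
  proof -
    have "e x div L = c (app q x)" "e x mod L = d x" "e y div L = c (app q y)" "e y mod L = d y"
      using d[OF x] d[OF y] by (simp_all add: e_def)
    then have c_eq: "c (app q x) = c (app q y)" and d_eq: "d x = d y"
      using \<open>e x = e y\<close> by simp_all
    \<comment> \<open>If \<open>q\<close> is decreasing on the piece, it swaps the order of
      \<open>x\<close> and \<open>y\<close>, so monotonicity of \<open>p\<close> is supplied in both
      orientations.\<close>
    show ?thesis
      using mono_q[OF x y \<open>x < y\<close> d_eq] mono_p[OF q_in[OF x] q_in[OF y] _ c_eq]
        mono_p[OF q_in[OF y] q_in[OF x] _ c_eq[symmetric]]
      by (cases s; cases t) simp_all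
  qed
  show ?thesis
    unfolding piecewise_monotone_def using bound mono by (intro exI[of _ e]) simp
qed

text \<open>Each summand is one piece.\<close>

lemma piecewise_monotone_foldr_perm_sum:
  assumes "\<forall>p\<in>set ps. decreasing p"
  shows "piecewise_monotone False (length ps) (foldr perm_sum ps (0, id))"
  using assms
proof (induction ps)
  case Nil
  show ?case
    by (simp add: piecewise_monotone_def)
next
  case (Cons p ps)
  define r where "r = foldr perm_sum ps (0, id)"
  have "piecewise_monotone False (length ps) r"
    using Cons unfolding r_def by (metis list.set_intros(2))
  then obtain c where c: "\<And>x. x \<in> {1..order r} \<Longrightarrow> c x < length ps"
    and mono: "\<And>x y. x \<in> {1..order r} \<Longrightarrow> y \<in> {1..order r} \<Longrightarrow> x < y \<Longrightarrow> c x = c y \<Longrightarrow>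
            app r y < app r x"
    unfolding piecewise_monotone_def if_False by blast
  have p: "app p i = order p + 1 - i" if "i \<in> {1..order p}" for i
    using Cons.prems that by (simp add: decreasing_def)
  \<comment> \<open>The first summand gets the fresh colour \<open>length ps\<close>; the colours of
    the shifted remainder are all smaller.\<close>
  define e where "e x = (if x \<le> order p then length ps else c (x - order p))" for x
  have shift: "x - order p \<in> {1..order r}"
    if "x \<in> {1..order p + order r}" "\<not> x \<le> order p" for x
    using that by auto
  have bound: "e x < Suc (length ps)" if "x \<in> {1..order p + order r}" for x
    using c[OF shift[OF that]] by (auto simp: e_def)
  have "app (perm_sum p r) y < app (perm_sum p r) x"
    if x: "x \<in> {1..order p + order r}" and y: "y \<in> {1..order p + order r}"
      and "x < y" and "e x = e y" for x y
  proof (cases "y \<le> order p")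
    case True
    then show ?thesis
      using x y \<open>x < y\<close> by (auto simp: perm_sum_def p)
  next
    \<comment> \<open>Now \<open>y\<close> lies beyond the first summand, so its colour is below
      \<open>length ps\<close>. Equality of colours puts \<open>x\<close> there too, and the claim
      reduces to \<open>r\<close>.\<close>
    case False
    have "\<not> x \<le> order p"
      using \<open>e x = e y\<close> False c[OF shift[OF y False]] by (auto simp: e_def)
    then show ?thesis
      using mono[OF shift[OF x] shift[OF y False]] False \<open>x < y\<close> \<open>e x = e y\<close>
      by (auto simp: perm_sum_def e_def)
  qed
  then have "piecewise_monotone False (Suc (length ps)) (perm_sum p r)"
    unfolding piecewise_monotone_def using bound by (intro exI[of _ e]) (simp add: perm_sum_def)
  then show ?case
    by (simp only: r_def foldr_Cons o_apply length_Cons)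
qed

lemma piecewise_monotone_mono:
  assumes "piecewise_monotone s K p" and "K \<le> L"
  shows "piecewise_monotone s L p"
proof -
  obtain c where "\<And>x. x \<in> {1..order p} \<Longrightarrow> c x < K"
    and mono: "\<forall>x\<in>{1..order p}. \<forall>y\<in>{1..order p}. x < y \<longrightarrow> c x = c y \<longrightarrow>
            (if s then app p x < app p y else app p y < app p x)"
    using assms(1) unfolding piecewise_monotone_def by blast
  then have "\<forall>x\<in>{1..order p}. c x < L"
    using assms(2) order_less_le_trans by blast
  with mono show ?thesis
    unfolding piecewise_monotone_def by blast
qed

lemma piecewise_monotone_layered:
  assumes "p \<in> layered_class k"
  shows "piecewise_monotone False k p"
proof -
  obtain ps where "p = foldr perm_sum ps (0, id)" "length ps \<le> k" "\<forall>q\<in>set ps. decreasing q"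
    using assms unfolding layered_class_def by blast
  then show ?thesis
    using piecewise_monotone_mono[OF piecewise_monotone_foldr_perm_sum] by simp
qed

text \<open>Each further factor multiplies the number of colours by \<open>k\<close> and flips the
  direction, so the direction is the parity of the length. \<open>is_perm\<close> is carried through
  the induction because the composition lemma requires it of the right-hand factor.\<close>

lemma piecewise_monotone_class_comp_list:
  assumes "Cs \<noteq> []"
    and "\<And>D p. D \<in> set Cs \<Longrightarrow> p \<in> D \<Longrightarrow> is_perm p \<and> piecewise_monotone False k p"
    and "p \<in> class_comp_list Cs"
  shows "is_perm p \<and> piecewise_monotone (even (length Cs)) (k ^ length Cs) p"
  using assms
proof (induction Cs arbitrary: p rule: class_comp_list.induct)
  case (2 C)
  then show ?case by simp
next
  case (3 C D Cs)
  then obtain u v where p: "p = (order u, app u \<circ> app v)"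
    and u: "u \<in> C" and v: "v \<in> class_comp_list (D # Cs)" and order_eq: "order u = order v"
    by (auto simp: class_comp_def)
  have "is_perm v \<and> piecewise_monotone (even (length (D # Cs))) (k ^ length (D # Cs)) v"
    using "3.prems"(2) v by (intro "3.IH") auto
  moreover have "is_perm u \<and> piecewise_monotone False k u"
    using "3.prems"(2)[of C u] u by simp
  ultimately show ?case
    using piecewise_monotone_comp[of False k u "even (length (D # Cs))" "k ^ length (D # Cs)" v]
      order_eq permutes_compose[of "app v" "{1..order v}" "app u"]
    by (simp add: p is_perm_def)
qed simp

lemma decreasing_exists: "\<exists>p. decreasing p \<and> order p = n"
proof -
  define f where "f i = (if i \<in> {1..n} then n + 1 - i else i)" for i
  have "bij_betw f {1..n} {1..n}"
    \<comment> \<open>Reversal is an involution, hence its own inverse.\<close>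
    by (rule bij_betw_byWitness[where f' = f]) (auto simp: f_def)
  then have "f permutes {1..n}"
    by (rule bij_imp_permutes) (auto simp: f_def)
  then have "decreasing (n, f)"
    by (simp add: decreasing_def is_perm_def f_def)
  then show ?thesis
    by (intro exI[of _ "(n, f)"]) simp
qed

text \<open>The \<open>foldr\<close> over \<open>[p]\<close> gives
  \<open>perm_sum p (0, id)\<close>, which stands in for \<open>p\<close> from here on; the two
  agree on \<open>{1..order p}\<close>.\<close>

lemma perm_sum_decreasing_in_layered_class:
  assumes "decreasing p" and "k \<ge> 1"
  shows "perm_sum p (0, id) \<in> layered_class k"
  unfolding layered_class_def using assms by (intro CollectI exI[of _ "[p]"]) simp

text \<open>Two positions of the same colour would form both an ascent and a descent. So all colours
  differ, and there are at most \<open>K\<close> of them.\<close>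

lemma decreasing_piecewise_increasing_order_le:
  assumes "decreasing p" and "piecewise_monotone True K (perm_sum p (0, id))"
  shows "order p \<le> K"
proof -
  have order_eq: "order (perm_sum p (0, id)) = order p"
    by (simp add: perm_sum_def)
  obtain c where c: "\<And>x. x \<in> {1..order p} \<Longrightarrow> c x < K"
    and mono: "\<And>x y. x \<in> {1..order p} \<Longrightarrow> y \<in> {1..order p} \<Longrightarrow> x < y \<Longrightarrow> c x = c y \<Longrightarrow>
            app (perm_sum p (0, id)) x < app (perm_sum p (0, id)) y"
    using assms(2) unfolding piecewise_monotone_def order_eq if_True by blast
  have "c x \<noteq> c y" if "x \<in> {1..order p}" "y \<in> {1..order p}" "x < y" for x y
    using mono[OF that] that assms(1) by (auto simp: decreasing_def perm_sum_def)
  then have "inj_on c {1..order p}"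
    by (intro linorder_inj_onI') auto
  moreover have "c ` {1..order p} \<subseteq> {..<K}"
    using c by auto
  ultimately show ?thesis
    using card_inj_on_le[of c "{1..order p}" "{..<K}"] by simp
qed

lemma layered_class_not_even_composable:
  assumes "k \<ge> 1" and "n > 0" and "even n"
  shows "\<not> composable n (layered_class k)"
proof
  assume "composable n (layered_class k)"
  then obtain Cs where len: "length Cs = n"
    and Cs: "\<And>D. D \<in> set Cs \<Longrightarrow> permutation_class D \<and> D \<subset> layered_class k"
    and sub: "layered_class k \<subseteq> class_comp_list Cs"
    unfolding composable_def by blast
  \<comment> \<open>One position more than the \<open>k ^ n\<close> colours available to a product
    of \<open>n\<close> factors.\<close>
  obtain p where p: "decreasing p" "order p = Suc (k ^ n)"
    using decreasing_exists by blast
  have "perm_sum p (0, id) \<in> class_comp_list Cs"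
    using perm_sum_decreasing_in_layered_class[OF p(1) assms(1)] sub by blast
  moreover have "is_perm q \<and> piecewise_monotone False k q" if "D \<in> set Cs" "q \<in> D" for D q
    using Cs[OF that(1)] that(2) piecewise_monotone_layered
    unfolding permutation_class_def by blast
  moreover have "Cs \<noteq> []"
    using len assms(2) by auto
  ultimately have "piecewise_monotone True (k ^ n) (perm_sum p (0, id))"
    using piecewise_monotone_class_comp_list[of Cs k "perm_sum p (0, id)"] len assms(3) by auto
  then show False
    using decreasing_piecewise_increasing_order_le[OF p(1)] p(2) by fastforce
qed

theorem proposition5p6:
  fixes k :: nat
  assumes "k \<ge> 4"
  shows "\<not> composable 2 (layered_class k) \<and>
         (\<forall>n::nat. n > 0 \<longrightarrow> even n \<longrightarrow> \<not> composable n (layered_class k))"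
  \<comment> \<open>The first conjunct is the instance \<open>n = 2\<close> of the second.\<close>
  using assms by (simp add: layered_class_not_even_composable)

end
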